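(* Any regular solution $(\zeta,\boldsymbol\phi_1,\boldsymbol\phi_2)$ to the Kakinuma model (K) satisfies the conservation of energy $$\partial_te^{\rm K}+\nabla\cdot\boldsymbol f_e^{\rm K}=0,$$ where $$e^{\rm K}=\tfrac12\rho_1\sum_{i,j=0}^N\Bigl(\tfrac{1}{2(i+j)+1}H_1^{2(i+j)+1}\nabla\phi_{1,i}\cdot\nabla\phi_{1,j}+\tfrac{4ij}{2(i+j)-1}H_1^{2(i+j)-1}\phi_{1,i}\phi_{1,j}\Bigr)$$ $$+\tfrac12\rho_2\sum_{i,j=0}^{N^*}\Bigl(\tfrac{1}{p_i+p_j+1}H_2^{p_i+p_j+1}\nabla\phi_{2,i}\cdot\nabla\phi_{2,j}-\tfrac{2p_i}{p_i+p_j}H_2^{p_i+p_j}\phi_{2,i}\nabla b\cdot\nabla\phi_{2,j}+\tfrac{p_ip_j}{p_i+p_j-1}H_2^{p_i+p_j-1}(1+|\nabla b|^2)\phi_{2,i}\phi_{2,j}\Bigr)+\tfrac12(\rho_2-\rho_1)g\zeta^2$$ and $$\boldsymbol f_e^{\rm K}=\rho_1\sum_{i,j=0}^N\Bigl(-\tfrac{1}{2(i+j)+1}H_1^{2(i+j)+1}\nabla\phi_{1,j}\Bigr)\partial_t\phi_{1,i}+\rho_2\sum_{i,j=0}^{N^*}\Bigl(-\tfrac{1}{p_i+p_j+1}H_2^{p_i+p_j+1}\nabla\phi_{2,j}+\tfrac{p_j}{p_i+p_j}H_2^{p_i+p_j}\phi_{2,j}\nabla b\Bigr)\partial_t\ph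i_{2,i}.$$
   Context: Fix integers $n\ge1$, $N,N^*\ge0$, integers $0=p_0<p_1<\dots<p_{N^*}$, and positive constants $g,\rho_1,\rho_2,h_1,h_2$. $\nabla$ acts on $\boldsymbol x\in\mathbf R^n$. The convention $\frac00=0$ is used for coefficients. The bottom topography $b=b(\boldsymbol x)$ is given; unknowns are $\zeta(\boldsymbol x,t)$, $\boldsymbol\phi_1=(\phi_{1,0},\dots,\phi_{1,N})^{\rm T}$, $\boldsymbol\phi_2=(\phi_{2,0},\dots,\phi_{2,N^*})^{\rm T}$; $H_1=h_1-\zeta$, $H_2=h_2+\zeta-b$ (positive). The **Kakinuma model (K)** is the system $$H_1^{2i}\partial_t\zeta-\sum_{j=0}^N\Bigl\{\nabla\cdot\Bigl(\tfrac{1}{2(i+j)+1}H_1^{2(i+j)+1}\nabla\phi_{1,j}\Bigr)-\tfrac{4ij}{2(i+j)-1}H_1^{2(i+j)-1}\phi_{1,j}\Bigr\}=0\quad(0\le i\le N),$$ $$H_2^{p_i}\partial_t\zeta+\sum_{j=0}^{N^*}\Bigl\{\nabla\cdot\Bigl(\tfrac{1}{p_i+p_j+1}H_2^{p_i+p_j+1}\nabla\phi_{2,j}-\tfrac{p_j}{p_i+p_j}H_2^{p_i+p_j}\phi_{2,j}\nabla b\Bigr)+\tfrac{p_i}{p_i+p_j}H_2^{p_i+p_j}\nabla b\cdot\nabla\phi_{2,j}-\tfrac{p_ip_j}{p_i+p_j-1}H_2^{p_i+p_j-1}(1+|\nabla b|^2)\phi_{2,j}\Bigr\}=0\quad(0\le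 i\le N^* ),$$ $$\rho_1\Bigl\{\sum_{j=0}^NH_1^{2j}\partial_t\phi_{1,j}+g\zeta+\tfrac12(|\boldsymbol u_1|^2+w_1^2)\Bigr\}-\rho_2\Bigl\{\sum_{j=0}^{N^*}H_2^{p_j}\partial_t\phi_{2,j}+g\zeta+\tfrac12(|\boldsymbol u_2|^2+w_2^2)\Bigr\}=0,$$ where $\boldsymbol u_1=\sum_jH_1^{2j}\nabla\phi_{1,j}$, $\boldsymbol u_2=\sum_j(H_2^{p_j}\nabla\phi_{2,j}-p_jH_2^{p_j-1}\phi_{2,j}\nabla b)$, $w_1=-\sum_j2jH_1^{2j-1}\phi_{1,j}$, $w_2=\sum_jp_jH_2^{p_j-1}\phi_{2,j}$. "Regular" means sufficiently smooth. *)

theory Defs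
  imports "HOL-Analysis.Analysis"
begin

section \<open>Differential operators\<close>

text \<open>A field depends on the position in \<open>real^'n\<close> and on the time, in this order.\<close>

type_synonym 'n field = "real^'n \<Rightarrow> real \<Rightarrow> real"

definition dt :: "'n::finite field \<Rightarrow> 'n field" where
  "dt f x t = deriv (f x) t"

definition grad :: "(real^'n::finite \<Rightarrow> real) \<Rightarrow> real^'n \<Rightarrow> real^'n" where
  "grad f x = (\<chi> k. frechet_derivative f (at x) (axis k 1))"

definition divg :: "(real^'n::finite \<Rightarrow> real^'n) \<Rightarrow> real^'n \<Rightarrow> real" where
  "divg F x = (\<Sum>k\<in>UNIV. frechet_derivative F (at x) (axis k 1) $ k)"

definition grad_x :: "'n::finite field \<Rightarrow> real^'n \<Rightarrow> real \<Rightarrow> real^'n" where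
  "grad_x f x t = grad (\<lambda>y. f y t) x"

text \<open>Functions of class \<open>C\<^sup>k\<close> on an open set \<open>S\<close>.\<close>

primrec C_on :: "nat \<Rightarrow> 'a::euclidean_space set \<Rightarrow> ('a \<Rightarrow> real) \<Rightarrow> bool" where
  "C_on 0 S f \<longleftrightarrow> continuous_on S f"
| "C_on (Suc k) S f \<longleftrightarrow>
     f differentiable_on S \<and> (\<forall>v\<in>Basis. C_on k S (\<lambda>z. frechet_derivative f (at z) v))"

section \<open>The Kakinuma model\<close>

definition upper_depth :: "real \<Rightarrow> 'n::finite field \<Rightarrow> 'n field" where
  "upper_depth h1 \<zeta> x t = h1 - \<zeta> x t"

definition lower_depth :: "real \<Rightarrow> (real^'n::finite \<Rightarrow> real) \<Rightarrow> 'n field \<Rightarrow> 'n field" where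
  "lower_depth h2 b \<zeta> x t = h2 + \<zeta> x t - b x"

text \<open>
  In the following, \<open>H\<close> is the depth of the layer in question. The exponents that are
  formally \<open>-1\<close> (at \<open>i = j = 0\<close>) are integers, not truncated naturals; the terms in which
  they occur have coefficient zero. The convention \<open>0/0 = 0\<close> for coefficients is that of
  division in HOL.
\<close>

definition u1 :: "nat \<Rightarrow> 'n::finite field \<Rightarrow> (nat \<Rightarrow> 'n field) \<Rightarrow> real^'n \<Rightarrow> real \<Rightarrow> real^'n" where
  "u1 N H \<phi> x t = (\<Sum>j\<le>N. H x t ^ (2 * j) *\<^sub>R grad_x (\<phi> j) x t)"

definition w1 :: "nat \<Rightarrow> 'n::finite field \<Rightarrow> (nat \<Rightarrow> 'n field) \<Rightarrow> 'n field" where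
  "w1 N H \<phi> x t = - (\<Sum>j\<le>N. 2 * real j * H x t powi (2 * int j - 1) * \<phi> j x t)"

definition u2 :: "nat \<Rightarrow> (nat \<Rightarrow> nat) \<Rightarrow> (real^'n::finite \<Rightarrow> real) \<Rightarrow> 'n field \<Rightarrow> (nat \<Rightarrow> 'n field) \<Rightarrow>
    real^'n \<Rightarrow> real \<Rightarrow> real^'n" where
  "u2 Ns p b H \<phi> x t =
     (\<Sum>j\<le>Ns. H x t ^ p j *\<^sub>R grad_x (\<phi> j) x t
            - (real (p j) * H x t powi (int (p j) - 1) * \<phi> j x t) *\<^sub>R grad b x)"

definition w2 :: "nat \<Rightarrow> (nat \<Rightarrow> nat) \<Rightarrow> 'n::finite field \<Rightarrow> (nat \<Rightarrow> 'n field) \<Rightarrow> 'n field" where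
  "w2 Ns p H \<phi> x t = (\<Sum>j\<le>Ns. real (p j) * H x t powi (int (p j) - 1) * \<phi> j x t)"

definition upper_mass_eq ::
  "nat \<Rightarrow> 'n::finite field \<Rightarrow> 'n field \<Rightarrow> (nat \<Rightarrow> 'n field) \<Rightarrow> nat \<Rightarrow> real^'n \<Rightarrow> real \<Rightarrow> bool" where
  "upper_mass_eq N H \<zeta> \<phi> i x t \<longleftrightarrow>
     H x t ^ (2 * i) * dt \<zeta> x t
     - (\<Sum>j\<le>N.
          divg (\<lambda>y. (1 / (2 * (real i + real j) + 1) * H y t ^ (2 * (i + j) + 1))
                      *\<^sub>R grad_x (\<phi> j) y t) x
          - 4 * real i * real j / (2 * (real i + real j) - 1)
              * H x t powi (2 * (int i + int j) - 1) * \<phi> j x t)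
     = 0"

definition lower_mass_eq ::
  "nat \<Rightarrow> (nat \<Rightarrow> nat) \<Rightarrow> (real^'n::finite \<Rightarrow> real) \<Rightarrow> 'n field \<Rightarrow> 'n field \<Rightarrow> (nat \<Rightarrow> 'n field) \<Rightarrow>
    nat \<Rightarrow> real^'n \<Rightarrow> real \<Rightarrow> bool" where
  "lower_mass_eq Ns p b H \<zeta> \<phi> i x t \<longleftrightarrow>
     H x t ^ p i * dt \<zeta> x t
     + (\<Sum>j\<le>Ns.
          divg (\<lambda>y. (1 / (real (p i) + real (p j) + 1) * H y t ^ (p i + p j + 1))
                      *\<^sub>R grad_x (\<phi> j) y t
                    - (real (p j) / (real (p i) + real (p j)) * H y t ^ (p i + p j) * \<phi> j y t)
                      *\<^sub>R grad b y) x
          + real (p i) / (real (p i) + real (p j)) * H x t ^ (p i + p j)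
              * (grad b x \<bullet> grad_x (\<phi> j) x t)
          - real (p i) * real (p j) / (real (p i) + real (p j) - 1)
              * H x t powi (int (p i) + int (p j) - 1) * (1 + (norm (grad b x))\<^sup>2) * \<phi> j x t)
     = 0"

definition bernoulli_eq ::
  "nat \<Rightarrow> nat \<Rightarrow> (nat \<Rightarrow> nat) \<Rightarrow> real \<Rightarrow> real \<Rightarrow> real \<Rightarrow> (real^'n::finite \<Rightarrow> real) \<Rightarrow>
    'n field \<Rightarrow> 'n field \<Rightarrow> 'n field \<Rightarrow> (nat \<Rightarrow> 'n field) \<Rightarrow> (nat \<Rightarrow> 'n field) \<Rightarrow>
    real^'n \<Rightarrow> real \<Rightarrow> bool" where
  "bernoulli_eq N Ns p g \<rho>1 \<rho>2 b H1 H2 \<zeta> \<phi>1 \<phi>2 x t \<longleftrightarrow>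
     \<rho>1 * ((\<Sum>j\<le>N. H1 x t ^ (2 * j) * dt (\<phi>1 j) x t) + g * \<zeta> x t
           + 1 / 2 * ((norm (u1 N H1 \<phi>1 x t))\<^sup>2 + (w1 N H1 \<phi>1 x t)\<^sup>2))
     - \<rho>2 * ((\<Sum>j\<le>Ns. H2 x t ^ p j * dt (\<phi>2 j) x t) + g * \<zeta> x t
           + 1 / 2 * ((norm (u2 Ns p b H2 \<phi>2 x t))\<^sup>2 + (w2 Ns p H2 \<phi>2 x t)\<^sup>2))
     = 0"

text \<open>The system at the point \<open>(x, t)\<close>; \<open>Ns\<close> stands for \<open>N\<^sup>*\<close>.\<close>

definition kakinuma_model ::
  "nat \<Rightarrow> nat \<Rightarrow> (nat \<Rightarrow> nat) \<Rightarrow> real \<Rightarrow> real \<Rightarrow> real \<Rightarrow> real \<Rightarrow> real \<Rightarrow> (real^'n::finite \<Rightarrow> real) \<Rightarrow>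
    'n field \<Rightarrow> (nat \<Rightarrow> 'n field) \<Rightarrow> (nat \<Rightarrow> 'n field) \<Rightarrow> real^'n \<Rightarrow> real \<Rightarrow> bool" where
  "kakinuma_model N Ns p g \<rho>1 \<rho>2 h1 h2 b \<zeta> \<phi>1 \<phi>2 x t \<longleftrightarrow>
     (\<forall>i\<le>N. upper_mass_eq N (upper_depth h1 \<zeta>) \<zeta> \<phi>1 i x t) \<and>
     (\<forall>i\<le>Ns. lower_mass_eq Ns p b (lower_depth h2 b \<zeta>) \<zeta> \<phi>2 i x t) \<and>
     bernoulli_eq N Ns p g \<rho>1 \<rho>2 b (upper_depth h1 \<zeta>) (lower_depth h2 b \<zeta>) \<zeta> \<phi>1 \<phi>2 x t"

text \<open>
  Regularity on \<open>\<real>\<^sup>n \<times> T\<close>, jointly in space and time. These classes are those needed for every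
  derivative in the system and in the energy balance to be a classical one, and for mixed
  second derivatives of the potentials to commute.
\<close>

definition regular_on ::
  "real set \<Rightarrow> nat \<Rightarrow> nat \<Rightarrow> (real^'n::finite \<Rightarrow> real) \<Rightarrow> 'n field \<Rightarrow> (nat \<Rightarrow> 'n field) \<Rightarrow>
    (nat \<Rightarrow> 'n field) \<Rightarrow> bool" where
  "regular_on T N Ns b \<zeta> \<phi>1 \<phi>2 \<longleftrightarrow>
     C_on 2 UNIV b \<and>
     C_on 1 (UNIV \<times> T) (\<lambda>(x, t). \<zeta> x t) \<and>
     (\<forall>j\<le>N. C_on 2 (UNIV \<times> T) (\<lambda>(x, t). \<phi>1 j x t)) \<and>
     (\<forall>j\<le>Ns. C_on 2 (UNIV \<times> T) (\<lambda>(x, t). \<phi>2 j x t))"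

section \<open>Energy density and energy flux\<close>

definition energy ::
  "nat \<Rightarrow> nat \<Rightarrow> (nat \<Rightarrow> nat) \<Rightarrow> real \<Rightarrow> real \<Rightarrow> real \<Rightarrow> (real^'n::finite \<Rightarrow> real) \<Rightarrow>
    'n field \<Rightarrow> 'n field \<Rightarrow> 'n field \<Rightarrow> (nat \<Rightarrow> 'n field) \<Rightarrow> (nat \<Rightarrow> 'n field) \<Rightarrow> 'n field" where
  "energy N Ns p g \<rho>1 \<rho>2 b H1 H2 \<zeta> \<phi>1 \<phi>2 x t =
     1 / 2 * \<rho>1 * (\<Sum>i\<le>N. \<Sum>j\<le>N.
         1 / (2 * (real i + real j) + 1) * H1 x t ^ (2 * (i + j) + 1)
           * (grad_x (\<phi>1 i) x t \<bullet> grad_x (\<phi>1 j) x t)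
         + 4 * real i * real j / (2 * (real i + real j) - 1)
           * H1 x t powi (2 * (int i + int j) - 1) * \<phi>1 i x t * \<phi>1 j x t)
     + 1 / 2 * \<rho>2 * (\<Sum>i\<le>Ns. \<Sum>j\<le>Ns.
         1 / (real (p i) + real (p j) + 1) * H2 x t ^ (p i + p j + 1)
           * (grad_x (\<phi>2 i) x t \<bullet> grad_x (\<phi>2 j) x t)
         - 2 * real (p i) / (real (p i) + real (p j)) * H2 x t ^ (p i + p j)
           * \<phi>2 i x t * (grad b x \<bullet> grad_x (\<phi>2 j) x t)
         + real (p i) * real (p j) / (real (p i) + real (p j) - 1)
           * H2 x t powi (int (p i) + int (p j) - 1) * (1 + (norm (grad b x))\<^sup>2)
           * \<phi>2 i x t * \<phi>2 j x t)
     + 1 / 2 * (\<rho>2 - \<rho>1) * g * (\<zeta> x t)\<^sup>2"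

definition energy_flux ::
  "nat \<Rightarrow> nat \<Rightarrow> (nat \<Rightarrow> nat) \<Rightarrow> real \<Rightarrow> real \<Rightarrow> (real^'n::finite \<Rightarrow> real) \<Rightarrow>
    'n field \<Rightarrow> 'n field \<Rightarrow> (nat \<Rightarrow> 'n field) \<Rightarrow> (nat \<Rightarrow> 'n field) \<Rightarrow> real^'n \<Rightarrow> real \<Rightarrow> real^'n" where
  "energy_flux N Ns p \<rho>1 \<rho>2 b H1 H2 \<phi>1 \<phi>2 x t =
     \<rho>1 *\<^sub>R (\<Sum>i\<le>N. \<Sum>j\<le>N.
         dt (\<phi>1 i) x t *\<^sub>R
           (- ((1 / (2 * (real i + real j) + 1) * H1 x t ^ (2 * (i + j) + 1))
               *\<^sub>R grad_x (\<phi>1 j) x t)))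
     + \<rho>2 *\<^sub>R (\<Sum>i\<le>Ns. \<Sum>j\<le>Ns.
         dt (\<phi>2 i) x t *\<^sub>R
           (- ((1 / (real (p i) + real (p j) + 1) * H2 x t ^ (p i + p j + 1))
               *\<^sub>R grad_x (\<phi>2 j) x t)
            + (real (p j) / (real (p i) + real (p j)) * H2 x t ^ (p i + p j) * \<phi>2 j x t)
               *\<^sub>R grad b x))"

end

theory Submission
  imports Defs
begin

text \<open>
  Multiply the \<open>i\<close>-th mass equation of a layer by \<open>\<partial>\<^sub>t\<phi>\<^sub>i\<close> and sum over \<open>i\<close>. Up to terms that are
  antisymmetric in \<open>(i, j)\<close> this shows that the kinetic energy \<open>e\<close> and the flux \<open>f\<close> of the layer
  satisfy \<open>\<partial>\<^sub>te + \<nabla>\<cdot>f = \<partial>\<^sub>tH (\<Sum>\<^sub>j H^(p\<^sub>j) \<partial>\<^sub>t\<phi>\<^sub>j + (|u|^2 + w^2) / 2)\<close>; the factor \<open>(|u|^2 + w^2) / 2\<close> is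
  the derivative of \<open>e\<close> with respect to the depth \<open>H\<close>. Since \<open>\<partial>\<^sub>tH\<^sub>1 = -\<partial>\<^sub>t\<zeta>\<close> and \<open>\<partial>\<^sub>tH\<^sub>2 = \<partial>\<^sub>t\<zeta>\<close>,
  adding both layers and the potential energy leaves \<open>-\<partial>\<^sub>t\<zeta>\<close> times the Bernoulli equation.
\<close>

section \<open>Partial derivatives of regular functions\<close>

text \<open>The mean value theorem is applied twice: along \<open>u\<close> to the difference of
  \<open>f\<close> between the two sides of the parallelogram parallel to \<open>u\<close>, then
  along \<open>v\<close> to the directional derivative \<open>f' w u\<close>. Hence only derivatives
  at points of the parallelogram enter.\<close>

lemma second_difference_MVT:
  fixes f :: "'a::real_normed_vector \<Rightarrow> real"
  assumes h: "h > 0"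
    and f: "\<And>w. w \<in> S \<Longrightarrow> (f has_derivative f' w) (at w)"
    and g: "\<And>w. w \<in> S \<Longrightarrow> ((\<lambda>w. f' w u) has_derivative g w) (at w)"
    and S: "\<And>r s. 0 \<le> r \<Longrightarrow> r \<le> h \<Longrightarrow> 0 \<le> s \<Longrightarrow> s \<le> h \<Longrightarrow> z + r *\<^sub>R u + s *\<^sub>R v \<in> S"
  obtains r s where "0 < r" "r < h" "0 < s" "s < h"
    "f (z + h *\<^sub>R u + h *\<^sub>R v) - f (z + h *\<^sub>R u) - f (z + h *\<^sub>R v) + f z
      = h * h * g (z + r *\<^sub>R u + s *\<^sub>R v) v"
proof -
  have 1: "((\<lambda>r. f (z + r *\<^sub>R u + s *\<^sub>R v)) has_real_derivative f' (z + r *\<^sub>R u + s *\<^sub>R v) u) (at r)"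
    if "0 \<le> r" "r \<le> h" "0 \<le> s" "s \<le> h" for r s
  proof -
    have d: "((\<lambda>r. z + r *\<^sub>R u + s *\<^sub>R v) has_derivative (\<lambda>d. d *\<^sub>R u)) (at r)"
      by (auto intro!: derivative_eq_intros)
    note F = f[OF S[OF that]]
    show ?thesis
      using has_derivative_compose[OF d F] linear_cmul[OF has_derivative_linear[OF F]]
      by (simp add: has_field_derivative_def mult_commute_abs)
  qed
  have 2: "((\<lambda>s. f' (z + r *\<^sub>R u + s *\<^sub>R v) u) has_real_derivative g (z + r *\<^sub>R u + s *\<^sub>R v) v) (at s)"
    if "0 \<le> r" "r \<le> h" "0 \<le> s" "s \<le> h" for r s
  proof -
    have d: "((\<lambda>s. z + r *\<^sub>R u + s *\<^sub>R v) has_derivative (\<lambda>d. d *\<^sub>R v)) (at s)"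
      by (auto intro!: derivative_eq_intros)
    note F = g[OF S[OF that]]
    show ?thesis
      using has_derivative_compose[OF d F] linear_cmul[OF has_derivative_linear[OF F]]
      by (simp add: has_field_derivative_def mult_commute_abs)
  qed
  have "\<exists>r. 0 < r \<and> r < h \<and>
      (f (z + h *\<^sub>R u + h *\<^sub>R v) - f (z + h *\<^sub>R u + 0 *\<^sub>R v)) - (f (z + 0 *\<^sub>R u + h *\<^sub>R v) - f (z + 0 *\<^sub>R u + 0 *\<^sub>R v))
       = (h - 0) * (f' (z + r *\<^sub>R u + h *\<^sub>R v) u - f' (z + r *\<^sub>R u + 0 *\<^sub>R v) u)"
    by (rule MVT2[OF h]) (intro DERIV_diff 1; use h in simp)
  then obtain r where r: "0 < r" "r < h"
    and e1: "f (z + h *\<^sub>R u + h *\<^sub>R v) - f (z + h *\<^sub>R u) - f (z + h *\<^sub>R v) + f z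
       = h * (f' (z + r *\<^sub>R u + h *\<^sub>R v) u - f' (z + r *\<^sub>R u + 0 *\<^sub>R v) u)"
    by auto
  have "\<exists>s. 0 < s \<and> s < h \<and> f' (z + r *\<^sub>R u + h *\<^sub>R v) u - f' (z + r *\<^sub>R u + 0 *\<^sub>R v) u
       = (h - 0) * g (z + r *\<^sub>R u + s *\<^sub>R v) v"
    by (rule MVT2[OF h]) (rule 2; use r in simp)
  then show ?thesis
    using that r e1 by auto
qed

text \<open>Both mixed derivatives are limits of the same second difference quotient.\<close>

lemma mixed_derivatives_commute:
  fixes f :: "'a::real_normed_vector \<Rightarrow> real"
  assumes "open S" "z \<in> S"
    and f: "\<And>w. w \<in> S \<Longrightarrow> (f has_derivative f' w) (at w)"
    and gu: "\<And>w. w \<in> S \<Longrightarrow> ((\<lambda>w. f' w u) has_derivative gu w) (at w)"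
    and gv: "\<And>w. w \<in> S \<Longrightarrow> ((\<lambda>w. f' w v) has_derivative gv w) (at w)"
    and cu: "continuous (at z) (\<lambda>w. gu w v)"
    and cv: "continuous (at z) (\<lambda>w. gv w u)"
  shows "gu z v = gv z u"
proof (rule ccontr)
  assume ne: "gu z v \<noteq> gv z u"
  \<comment> \<open>Two errors that are each below \<open>e\<close> cannot bridge the gap
    \<open>2 * e\<close> between the two mixed derivatives.\<close>
  define e where "e = dist (gu z v) (gv z u) / 2"
  have e: "e > 0"
    using ne by (simp add: e_def)
  obtain d0 where d0: "d0 > 0" "ball z d0 \<subseteq> S"
    using assms(1,2) openE by blast
  obtain d1 where d1: "d1 > 0" "\<And>w. dist w z < d1 \<Longrightarrow> dist (gu w v) (gu z v) < e"
    using cu e unfolding continuous_at_eps_delta by metis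
  obtain d2 where d2: "d2 > 0" "\<And>w. dist w z < d2 \<Longrightarrow> dist (gv w u) (gv z u) < e"
    using cv e unfolding continuous_at_eps_delta by metis
  define d where "d = min d0 (min d1 d2)"
  have d: "d > 0" "d \<le> d0" "d \<le> d1" "d \<le> d2"
    using d0 d1 d2 by (auto simp: d_def)
  \<comment> \<open>The parallelogram spanned by \<open>h\<close> times \<open>u\<close> and
    \<open>h\<close> times \<open>v\<close> then stays within distance \<open>d / 2\<close> of
    \<open>z\<close>. The summand 1 keeps the denominator positive when \<open>u\<close> and
    \<open>v\<close> both vanish.\<close>
  define h where "h = d / (2 * (1 + norm u + norm v))"
  have p: "1 + norm u + norm v > 0"
    by (meson add_pos_nonneg norm_ge_zero zero_less_one)
  have h: "h > 0"
    unfolding h_def using d(1) p by simp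
  have near: "dist (z + r *\<^sub>R u + s *\<^sub>R v) z < d"
    if "0 \<le> r" "r \<le> h" "0 \<le> s" "s \<le> h" for r s
  proof -
    have "dist (z + r *\<^sub>R u + s *\<^sub>R v) z = norm (r *\<^sub>R u + s *\<^sub>R v)"
      by (simp add: dist_norm add.assoc)
    also have "\<dots> \<le> r * norm u + s * norm v"
      using that norm_triangle_ineq[of "r *\<^sub>R u" "s *\<^sub>R v"] by simp
    also have "\<dots> \<le> h * norm u + h * norm v"
      using that by (intro add_mono mult_right_mono) auto
    also have "\<dots> \<le> h * (1 + norm u + norm v)"
      using h by (simp add: algebra_simps)
    also have "\<dots> = d / 2"
      unfolding h_def using p by (simp add: field_simps)
    finally show ?thesis
      using d(1) by simp
  qed
  have S: "z + r *\<^sub>R u + s *\<^sub>R v \<in> S"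
    if "0 \<le> r" "r \<le> h" "0 \<le> s" "s \<le> h" for r s
    using near[OF that] d(2) d0(2) by (auto simp: dist_commute)
  obtain r s where rs: "0 < r" "r < h" "0 < s" "s < h"
    "f (z + h *\<^sub>R u + h *\<^sub>R v) - f (z + h *\<^sub>R u) - f (z + h *\<^sub>R v) + f z
      = h * h * gu (z + r *\<^sub>R u + s *\<^sub>R v) v"
    using second_difference_MVT[OF h f gu S] by blast
  have S': "z + r *\<^sub>R v + s *\<^sub>R u \<in> S"
    if "0 \<le> r" "r \<le> h" "0 \<le> s" "s \<le> h" for r s
    using S[OF that(3,4,1,2)] by (simp add: algebra_simps)
  obtain r' s' where rs': "0 < r'" "r' < h" "0 < s'" "s' < h"
    "f (z + h *\<^sub>R v + h *\<^sub>R u) - f (z + h *\<^sub>R v) - f (z + h *\<^sub>R u) + f z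
      = h * h * gv (z + r' *\<^sub>R v + s' *\<^sub>R u) u"
    using second_difference_MVT[OF h f gv S'] by blast
  \<comment> \<open>The second difference is unchanged when \<open>u\<close> and \<open>v\<close>
    are exchanged, so both mean values describe the same number.\<close>
  have "h * h * gu (z + r *\<^sub>R u + s *\<^sub>R v) v = h * h * gv (z + r' *\<^sub>R v + s' *\<^sub>R u) u"
    using rs(5) rs'(5) by (simp add: algebra_simps)
  then have eq: "gu (z + r *\<^sub>R u + s *\<^sub>R v) v = gv (z + s' *\<^sub>R u + r' *\<^sub>R v) u"
    using h by (simp add: algebra_simps)
  have "dist (gu (z + r *\<^sub>R u + s *\<^sub>R v) v) (gu z v) < e"
    using near[of r s] rs d(3) by (intro d1(2)) auto
  moreover have "dist (gv (z + s' *\<^sub>R u + r' *\<^sub>R v) u) (gv z u) < e"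
    using near[of s' r'] rs' d(4) by (intro d2(2)) auto
  ultimately have "dist (gu z v) (gv z u) < 2 * e"
    unfolding eq using dist_triangle3[of "gu z v" "gv z u" "gv (z + s' *\<^sub>R u + r' *\<^sub>R v) u"] by linarith
  then show False
    by (simp add: e_def)
qed

section \<open>Time and space slices of a derivative; derivatives by components\<close>

lemma has_derivative_slice_time:
  fixes f :: "'n::finite field"
  assumes F: "((\<lambda>(x, t). f x t) has_derivative D) (at (x, t))"
  shows "((\<lambda>s. f x s) has_real_derivative D (0, 1)) (at t)"
proof -
  have "((\<lambda>s. (x, s)) has_derivative (\<lambda>d. (0, d))) (at t)"
    by (intro has_derivative_Pair has_derivative_const has_derivative_ident)
  from has_derivative_compose[OF this F]
  have "((\<lambda>s. f x s) has_derivative (\<lambda>d. D (0, d))) (at t)"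
    by simp
  moreover have "(\<lambda>d. D (0, d)) = (*) (D (0, 1))"
  proof
    fix d
    show "D (0, d) = D (0, 1) * d"
      using linear_cmul[OF has_derivative_linear[OF F], of d "(0, 1)"] by (simp add: mult.commute)
  qed
  ultimately show ?thesis
    unfolding has_field_derivative_def by metis
qed

lemma has_derivative_slice_space:
  fixes f :: "'n::finite field"
  assumes F: "((\<lambda>(x, t). f x t) has_derivative D) (at (x, t))"
  shows "((\<lambda>y. f y t) has_derivative (\<lambda>a. D (a, 0))) (at x)"
proof -
  have "((\<lambda>y. (y, t)) has_derivative (\<lambda>a. (a, 0))) (at x)"
    by (intro has_derivative_Pair has_derivative_const has_derivative_ident)
  from has_derivative_compose[OF this F] show ?thesis
    by simp
qed

lemma dt_eq:
  fixes f :: "'n::finite field"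
  assumes "((\<lambda>(x, t). f x t) has_derivative D) (at (x, t))"
  shows "dt f x t = D (0, 1)"
  unfolding dt_def by (rule DERIV_imp_deriv[OF has_derivative_slice_time[OF assms]])

lemma grad_eq:
  assumes "(f has_derivative D) (at x)"
  shows "grad f x = (\<chi> k. D (axis k 1))"
  using frechet_derivative_at[OF assms] by (simp add: grad_def)

lemma grad_x_eq:
  fixes f :: "'n::finite field"
  assumes "((\<lambda>(x, t). f x t) has_derivative D) (at (x, t))"
  shows "grad_x f x t = (\<chi> k. D (axis k 1, 0))"
  unfolding grad_x_def by (rule grad_eq[OF has_derivative_slice_space[OF assms]])

lemma has_derivative_vec_iff:
  fixes F :: "'a::real_normed_vector \<Rightarrow> real^'n::finite"
  shows "(F has_derivative D) (at x within S) \<longleftrightarrow>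
    (\<forall>k. ((\<lambda>y. F y $ k) has_derivative (\<lambda>h. D h $ k)) (at x within S))"
  unfolding has_derivative_componentwise_within[of F] by (simp add: Basis_vec_def inner_axis)

lemma differentiable_vec:
  fixes F :: "'a::real_normed_vector \<Rightarrow> real^'n::finite"
  assumes "\<And>k. (\<lambda>y. F y $ k) differentiable (at x within S)"
  shows "F differentiable (at x within S)"
proof -
  define D where "D k = frechet_derivative (\<lambda>y. F y $ k) (at x within S)" for k
  have "((\<lambda>y. F y $ k) has_derivative D k) (at x within S)" for k
    unfolding D_def using assms by (simp add: frechet_derivative_works)
  then have "(F has_derivative (\<lambda>h. \<chi> k. D k h)) (at x within S)"
    unfolding has_derivative_vec_iff by simp
  then show ?thesis
    unfolding differentiable_def by blast
qed

lemma has_vector_derivative_vec: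
  fixes F :: "real \<Rightarrow> real^'n::finite"
  assumes "\<And>k. ((\<lambda>s. F s $ k) has_real_derivative D $ k) (at t)"
  shows "(F has_vector_derivative D) (at t)"
  using assms
  unfolding has_vector_derivative_def has_derivative_vec_iff has_field_derivative_def
  by (simp add: mult_commute_abs)

section \<open>Consequences of the classes \<open>C_on 1\<close> and \<open>C_on 2\<close>\<close>

lemma C_on_Suc_has_derivative:
  assumes "C_on (Suc k) S f" "open S" "z \<in> S"
  shows "(f has_derivative frechet_derivative f (at z)) (at z)"
  using assms by (simp add: differentiable_on_eq_differentiable_at frechet_derivative_works)

lemma C2_on_partial_has_derivative:
  assumes "C_on 2 S f" "open S" "z \<in> S" "v \<in> Basis"
  shows "((\<lambda>z. frechet_derivative f (at z) v) has_derivative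
    frechet_derivative (\<lambda>z. frechet_derivative f (at z) v) (at z)) (at z)"
  using assms C_on_Suc_has_derivative[of 0 S "\<lambda>z. frechet_derivative f (at z) v"]
  by (simp add: numeral_2_eq_2)

lemma C2_on_mixed_commute:
  assumes f: "C_on 2 S f" and "open S" "z \<in> S" "u \<in> Basis" "v \<in> Basis"
  shows "frechet_derivative (\<lambda>z. frechet_derivative f (at z) u) (at z) v
       = frechet_derivative (\<lambda>z. frechet_derivative f (at z) v) (at z) u"
proof (rule mixed_derivatives_commute[OF \<open>open S\<close> \<open>z \<in> S\<close>])
  show "(f has_derivative frechet_derivative f (at w)) (at w)" if "w \<in> S" for w
    by (rule C_on_Suc_has_derivative[OF f[unfolded numeral_2_eq_2] \<open>open S\<close> that])
  show "((\<lambda>z. frechet_derivative f (at z) u) has_derivative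
      frechet_derivative (\<lambda>z. frechet_derivative f (at z) u) (at w)) (at w)" if "w \<in> S" for w
    by (rule C2_on_partial_has_derivative[OF f \<open>open S\<close> that \<open>u \<in> Basis\<close>])
  show "((\<lambda>z. frechet_derivative f (at z) v) has_derivative
      frechet_derivative (\<lambda>z. frechet_derivative f (at z) v) (at w)) (at w)" if "w \<in> S" for w
    by (rule C2_on_partial_has_derivative[OF f \<open>open S\<close> that \<open>v \<in> Basis\<close>])
  show "continuous (at z) (\<lambda>w. frechet_derivative (\<lambda>z. frechet_derivative f (at z) u) (at w) v)"
    "continuous (at z) (\<lambda>w. frechet_derivative (\<lambda>z. frechet_derivative f (at z) v) (at w) u)"
    using assms by (auto simp: numeral_2_eq_2 continuous_on_eq_continuous_at)
qed

text \<open>The first partial derivatives are differentiable and therefore continuous, which is all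
  that \<open>C_on 1\<close> asks beyond differentiability.\<close>

lemma C2_on_imp_C1_on:
  assumes "C_on 2 S f"
  shows "C_on 1 S f"
proof -
  have f: "f differentiable_on S"
    and d: "\<And>v. v \<in> Basis \<Longrightarrow> (\<lambda>z. frechet_derivative f (at z) v) differentiable_on S"
    using assms by (simp_all add: numeral_2_eq_2)
  show ?thesis
    using f differentiable_imp_continuous_on[OF d] by simp
qed

context
  fixes T :: "real set" and f :: "'n::finite field" and x :: "real^'n" and t :: real
  assumes T: "open T" "t \<in> T"
begin

lemma C1_on_spacetime:
  assumes f: "C_on 1 (UNIV \<times> T) (\<lambda>(x, t). f x t)"
  shows "((\<lambda>s. f x s) has_real_derivative dt f x t) (at t)"
    and "(\<lambda>y. f y t) differentiable (at x)"
proof -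
  note D = C_on_Suc_has_derivative[OF f[unfolded One_nat_def] open_Times[OF open_UNIV T(1)],
      of "(x, t)"]
  show "((\<lambda>s. f x s) has_real_derivative dt f x t) (at t)"
    using has_derivative_slice_time[OF D] dt_eq[OF D] T by simp
  show "(\<lambda>y. f y t) differentiable (at x)"
    using has_derivative_slice_space[OF D] T unfolding differentiable_def by blast
qed

text \<open>In space-time, \<open>dt\<close> is the derivative along \<open>(0, 1)\<close> and the
  \<open>k\<close>-th component of \<open>grad_x\<close> the one along \<open>(axis k 1, 0)\<close>.
  Symmetry of these mixed derivatives gives the first claim, through which the time derivative of
  the energy produces the same terms as the divergence of the flux.\<close>

lemma C2_on_spacetime:
  assumes f: "C_on 2 (UNIV \<times> T) (\<lambda>(x, t). f x t)"
  shows "((\<lambda>s. grad_x f x s) has_vector_derivative grad_x (dt f) x t) (at t)"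
    and "(\<lambda>y. grad_x f y t) differentiable (at x)"
    and "(\<lambda>y. dt f y t) differentiable (at x)"
proof -
  let ?F = "\<lambda>(x, t). f x t"
  let ?P = "\<lambda>v z. frechet_derivative ?F (at z) v"
  have S: "open ((UNIV :: (real^'n) set) \<times> T)"
    using T by (simp add: open_Times)
  have B: "(0, 1) \<in> (Basis :: ((real^'n) \<times> real) set)"
    "(axis k 1, 0) \<in> (Basis :: ((real^'n) \<times> real) set)" for k
    by (auto simp: Basis_prod_def)
  have D: "(?F has_derivative frechet_derivative ?F (at (y, s))) (at (y, s))" if "s \<in> T" for y s
    using that by (intro C_on_Suc_has_derivative[OF f[unfolded numeral_2_eq_2] S]) simp
  have d: "dt f y s = ?P (0, 1) (y, s)" if "s \<in> T" for y s
    using dt_eq[OF D[OF that]] .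
  have gr: "grad_x f y s $ k = ?P (axis k 1, 0) (y, s)" if "s \<in> T" for y s k
    using grad_x_eq[OF D[OF that]] by simp
  have P: "((\<lambda>(y, s). ?P v (y, s)) has_derivative frechet_derivative (?P v) (at (y, s))) (at (y, s))"
    if "s \<in> T" "v \<in> Basis" for y s v
    unfolding case_prod_eta[of "?P v"]
    using C2_on_partial_has_derivative[OF f S _ that(2), of "(y, s)"] that by simp
  have dtP: "((\<lambda>y. dt f y t) has_derivative (\<lambda>a. frechet_derivative (?P (0, 1)) (at (x, t)) (a, 0))) (at x)"
    using has_derivative_slice_space[OF P[OF T(2) B(1)]] d[OF T(2)] by simp
  then show "(\<lambda>y. dt f y t) differentiable (at x)"
    unfolding differentiable_def by blast
  have "(\<lambda>y. grad_x f y t $ k) differentiable (at x)" for k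
    using has_derivative_slice_space[OF P[OF T(2) B(2)[of k]]] gr[OF T(2)]
    unfolding differentiable_def by auto
  then show "(\<lambda>y. grad_x f y t) differentiable (at x)"
    by (rule differentiable_vec)
  show "((\<lambda>s. grad_x f x s) has_vector_derivative grad_x (dt f) x t) (at t)"
  proof (rule has_vector_derivative_vec)
    fix k
    have "((\<lambda>s. ?P (axis k 1, 0) (x, s)) has_real_derivative
        frechet_derivative (?P (axis k 1, 0)) (at (x, t)) (0, 1)) (at t)"
      using has_derivative_slice_time[OF P[OF T(2) B(2)[of k]]] .
    \<comment> \<open>The gradient is identified with partial derivatives only at times in
      \<open>T\<close>; openness of \<open>T\<close> makes this enough for a derivative at
      \<open>t\<close>.\<close>
    then have "((\<lambda>s. grad_x f x s $ k) has_real_derivative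
        frechet_derivative (?P (axis k 1, 0)) (at (x, t)) (0, 1)) (at t)"
      by (rule has_field_derivative_transform_within_open[OF _ T]) (simp add: gr)
    moreover have "grad_x (dt f) x t $ k = frechet_derivative (?P (0, 1)) (at (x, t)) (axis k 1, 0)"
      unfolding grad_x_def grad_eq[OF dtP] by simp
    ultimately show "((\<lambda>s. grad_x f x s $ k) has_real_derivative grad_x (dt f) x t $ k) (at t)"
      using C2_on_mixed_commute[OF f S _ B(1) B(2)[of k], of "(x, t)"] T by simp
  qed
qed

end

lemma C2_on_grad_differentiable:
  assumes b: "C_on 2 UNIV b"
  shows "grad b differentiable (at x)"
proof (rule differentiable_vec)
  fix k
  show "(\<lambda>y. grad b y $ k) differentiable (at x)"
    using C2_on_partial_has_derivative[OF b, of x "axis k 1"]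
    by (auto simp: grad_def differentiable_def)
qed

section \<open>Rules for the divergence and for double sums\<close>

lemma divg_eq:
  assumes "(F has_derivative D) (at x)"
  shows "divg F x = (\<Sum>k\<in>UNIV. D (axis k 1) $ k)"
  using frechet_derivative_at[OF assms] by (simp add: divg_def)

lemma divg_sum:
  assumes "\<And>i. i \<in> A \<Longrightarrow> F i differentiable (at x)"
  shows "divg (\<lambda>y. \<Sum>i\<in>A. F i y) x = (\<Sum>i\<in>A. divg (F i) x)"
proof -
  have "((\<lambda>y. \<Sum>i\<in>A. F i y) has_derivative (\<lambda>h. \<Sum>i\<in>A. frechet_derivative (F i) (at x) h)) (at x)"
    using assms by (intro has_derivative_sum) (simp add: frechet_derivative_works)
  from divg_eq[OF this] show ?thesis
    by (simp add: divg_def sum.swap[of _ A])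
qed

lemma divg_scaleR:
  fixes f :: "real^'n::finite \<Rightarrow> real"
  assumes "f differentiable (at x)" "F differentiable (at x)"
  shows "divg (\<lambda>y. f y *\<^sub>R F y) x = f x * divg F x + grad f x \<bullet> F x"
proof -
  have "((\<lambda>y. f y *\<^sub>R F y) has_derivative
      (\<lambda>h. f x *\<^sub>R frechet_derivative F (at x) h + frechet_derivative f (at x) h *\<^sub>R F x)) (at x)"
    using assms by (intro has_derivative_scaleR) (simp_all add: frechet_derivative_works)
  from divg_eq[OF this] show ?thesis
    by (simp add: divg_def grad_def inner_vec_def sum.distrib sum_distrib_left)
qed

lemma grad_const [simp]: "grad (\<lambda>_. c) x = 0"
  by (simp add: grad_def vec_eq_iff)

lemma divg_scaleR_const:
  assumes "F differentiable (at x)"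
  shows "divg (\<lambda>y. c *\<^sub>R F y) x = c * divg F x"
  using divg_scaleR[OF _ assms, of "\<lambda>_. c"] by simp

lemma divg_add:
  assumes "F differentiable (at x)" "G differentiable (at x)"
  shows "divg (\<lambda>y. F y + G y) x = divg F x + divg G x"
proof -
  have "((\<lambda>y. F y + G y) has_derivative
      (\<lambda>h. frechet_derivative F (at x) h + frechet_derivative G (at x) h)) (at x)"
    using assms by (intro has_derivative_add) (simp_all add: frechet_derivative_works)
  from divg_eq[OF this] show ?thesis
    by (simp add: divg_def sum.distrib)
qed

text \<open>Adding the sum to itself with the indices exchanged cancels it term by term. This
  reduces the energy balance of a layer to an algebraic identity for a single pair of
  indices.\<close>

lemma sum_sum_antisymmetric:
  fixes s :: "'i \<Rightarrow> 'i \<Rightarrow> real"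
  assumes "\<And>i j. s i j + s j i = 0"
  shows "(\<Sum>i\<in>A. \<Sum>j\<in>A. s i j) = 0"
proof -
  have "2 * (\<Sum>i\<in>A. \<Sum>j\<in>A. s i j) = (\<Sum>i\<in>A. \<Sum>j\<in>A. s i j) + (\<Sum>i\<in>A. \<Sum>j\<in>A. s j i)"
    using sum.swap[of s A A] by simp
  also have "\<dots> = (\<Sum>i\<in>A. \<Sum>j\<in>A. s i j + s j i)"
    by (simp add: sum.distrib)
  finally show ?thesis
    by (simp add: assms)
qed

section \<open>Time derivative of one summand of the kinetic energy\<close>

lemma has_real_derivative_inner:
  assumes "(F has_vector_derivative F') (at t)" "(G has_vector_derivative G') (at t)"
  shows "((\<lambda>s. F s \<bullet> G s) has_real_derivative F' \<bullet> G t + F t \<bullet> G') (at t)"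
proof -
  have "((\<lambda>s. F s \<bullet> G s) has_derivative (\<lambda>d. F t \<bullet> (d *\<^sub>R G') + (d *\<^sub>R F') \<bullet> G t)) (at t)"
    using assms unfolding has_vector_derivative_def by (rule has_derivative_inner)
  moreover have "(\<lambda>d. F t \<bullet> (d *\<^sub>R G') + (d *\<^sub>R F') \<bullet> G t) = (*) (F' \<bullet> G t + F t \<bullet> G')"
    by (auto simp: fun_eq_iff algebra_simps)
  ultimately show ?thesis
    by (simp add: has_field_derivative_def)
qed

text \<open>The denominators of the coefficients are exactly the exponents of the depth, so they
  cancel on differentiating by \<open>H\<close>. What remains as the factor of \<open>H'\<close>
  splits into products of a factor in \<open>q\<close> and a factor in \<open>r\<close>, which is
  the shape of an expanded square of velocities. \<open>\<beta>\<close> and \<open>B\<close> stand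
  for the bottom slope and one plus its squared norm, both constant in time.\<close>

lemma layer_energy_term_derivative:
  fixes H f1 f2 :: "real \<Rightarrow> real" and G1 G2 :: "real \<Rightarrow> 'v::real_inner"
  assumes H0: "H t \<noteq> 0"
    and H: "(H has_real_derivative H') (at t)"
    and f1: "(f1 has_real_derivative f1') (at t)"
    and f2: "(f2 has_real_derivative f2') (at t)"
    and G1: "(G1 has_vector_derivative G1') (at t)"
    and G2: "(G2 has_vector_derivative G2') (at t)"
  shows "((\<lambda>s. 1 / (real q + real r + 1) * H s ^ (q + r + 1) * (G1 s \<bullet> G2 s)
        - 2 * real q / (real q + real r) * H s ^ (q + r) * f1 s * (\<beta> \<bullet> G2 s)
        + real q * real r / (real q + real r - 1) * H s powi (int q + int r - 1) * B * f1 s * f2 s)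
      has_real_derivative
        1 / (real q + real r + 1) * H t ^ (q + r + 1) * (G1' \<bullet> G2 t + G1 t \<bullet> G2')
        - 2 * real q / (real q + real r) * H t ^ (q + r) * (f1' * (\<beta> \<bullet> G2 t) + f1 t * (\<beta> \<bullet> G2'))
        + real q * real r / (real q + real r - 1) * H t powi (int q + int r - 1) * B
            * (f1' * f2 t + f1 t * f2')
        + H' * (H t ^ q * H t ^ r * (G1 t \<bullet> G2 t)
            - 2 * (real q * H t powi (int q - 1)) * H t ^ r * f1 t * (\<beta> \<bullet> G2 t)
            + (real q * H t powi (int q - 1)) * (real r * H t powi (int r - 1)) * B * f1 t * f2 t))
      (at t)"
proof -
  have 1: "((\<lambda>s. 1 / (real q + real r + 1) * H s ^ (q + r + 1)) has_real_derivative
      H t ^ q * H t ^ r * H') (at t)"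
    by (rule derivative_eq_intros H refl | simp add: power_add field_simps)+
  have 2: "((\<lambda>s. 2 * real q / (real q + real r) * H s ^ (q + r)) has_real_derivative
      2 * (real q * H t powi (int q - 1)) * H t ^ r * H') (at t)"
  \<comment> \<open>For \<open>q = 0\<close> both sides vanish, also when \<open>r = 0\<close> turns
    the coefficient into \<open>0 / 0\<close>. Otherwise \<open>q + r\<close> is positive and
    cancels.\<close>
  proof (cases q)
    case (Suc k)
    have "real (Suc k) + real r \<noteq> 0"
      by simp
    then show ?thesis
      unfolding Suc
      by - (rule derivative_eq_intros H refl | simp add: power_add field_simps)+
  qed simp
  have 3: "((\<lambda>s. real q * real r / (real q + real r - 1) * H s powi (int q + int r - 1)) has_real_derivative
      (real q * H t powi (int q - 1)) * (real r * H t powi (int r - 1)) * H') (at t)"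
  \<comment> \<open>If one exponent is zero, the coefficient and the claimed derivative both vanish.
    Otherwise \<open>q + r - 1\<close> is at least 1, so it cancels.\<close>
  proof (cases "real q * real r = 0")
    case False
    then have nz: "real q + real r - 1 \<noteq> 0"
      by (cases q; cases r) auto
    have "((\<lambda>s. H s powi (int q + int r - 1)) has_real_derivative
        of_int (int q + int r - 1) * H t powi (int q + int r - 1 - 1) * H') (at t)"
      using H0 H by (auto intro!: derivative_eq_intros)
    moreover have "H t powi (int q + int r - 1 - 1) = H t powi (int q - 1) * H t powi (int r - 1)"
      using H0 by (simp add: power_int_add[symmetric] algebra_simps)
    ultimately have "((\<lambda>s. H s powi (int q + int r - 1)) has_real_derivative
        (real q + real r - 1) * (H t powi (int q - 1) * H t powi (int r - 1)) * H') (at t)"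
      by simp
    from DERIV_cmult[OF this, of "real q * real r / (real q + real r - 1)"] nz show ?thesis
      by (simp add: mult_ac)
  qed auto
  have in1: "((\<lambda>s. G1 s \<bullet> G2 s) has_real_derivative G1' \<bullet> G2 t + G1 t \<bullet> G2') (at t)"
    by (rule has_real_derivative_inner[OF G1 G2])
  have in2: "((\<lambda>s. \<beta> \<bullet> G2 s) has_real_derivative \<beta> \<bullet> G2') (at t)"
    using has_real_derivative_inner[OF has_vector_derivative_const G2, of \<beta>] by simp
  note D = DERIV_add[OF DERIV_diff[OF DERIV_mult[OF 1 in1] DERIV_mult[OF DERIV_mult[OF 2 f1] in2]]
      DERIV_mult[OF DERIV_mult[OF DERIV_cmult_right[OF 3, of B] f1] f2]]
  show ?thesis
    by (rule DERIV_cong[OF D]) (simp only: algebra_simps)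
qed

section \<open>Energy balance of a single layer\<close>

text \<open>Kinetic energy of one layer per unit density. Exponents and bottom stay arbitrary so
  that both layers are instances.\<close>

definition layer_energy ::
  "nat \<Rightarrow> (nat \<Rightarrow> nat) \<Rightarrow> (real^'n::finite \<Rightarrow> real) \<Rightarrow> 'n field \<Rightarrow> (nat \<Rightarrow> 'n field) \<Rightarrow> 'n field" where
  "layer_energy Ns p b H \<phi> x t =
     1 / 2 * (\<Sum>i\<le>Ns. \<Sum>j\<le>Ns.
         1 / (real (p i) + real (p j) + 1) * H x t ^ (p i + p j + 1)
           * (grad_x (\<phi> i) x t \<bullet> grad_x (\<phi> j) x t)
         - 2 * real (p i) / (real (p i) + real (p j)) * H x t ^ (p i + p j)
           * \<phi> i x t * (grad b x \<bullet> grad_x (\<phi> j) x t)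
         + real (p i) * real (p j) / (real (p i) + real (p j) - 1)
           * H x t powi (int (p i) + int (p j) - 1) * (1 + (norm (grad b x))\<^sup>2)
           * \<phi> i x t * \<phi> j x t)"

definition layer_flux ::
  "nat \<Rightarrow> (nat \<Rightarrow> nat) \<Rightarrow> (real^'n::finite \<Rightarrow> real) \<Rightarrow> 'n field \<Rightarrow> (nat \<Rightarrow> 'n field) \<Rightarrow>
    real^'n \<Rightarrow> real \<Rightarrow> real^'n" where
  "layer_flux Ns p b H \<phi> x t =
     (\<Sum>i\<le>Ns. \<Sum>j\<le>Ns.
         dt (\<phi> i) x t *\<^sub>R
           (- ((1 / (real (p i) + real (p j) + 1) * H x t ^ (p i + p j + 1))
               *\<^sub>R grad_x (\<phi> j) x t)
            + (real (p j) / (real (p i) + real (p j)) * H x t ^ (p i + p j) * \<phi> j x t)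
               *\<^sub>R grad b x))"

text \<open>All facts concern the single point \<open>(x, t)\<close>, in the form that the product
  rules consume. The exchange of time derivative and gradient is already contained in
  \<open>grad_\<phi>_time\<close>.\<close>

locale regular_layer =
  fixes Ns :: nat and p :: "nat \<Rightarrow> nat" and b :: "real^'n::finite \<Rightarrow> real"
    and H :: "'n field" and \<phi> :: "nat \<Rightarrow> 'n field" and x :: "real^'n" and t :: real
  assumes H_nonzero: "H x t \<noteq> 0"
    and H_time: "((\<lambda>s. H x s) has_real_derivative dt H x t) (at t)"
    and H_space: "(\<lambda>y. H y t) differentiable (at x)"
    and grad_b_space: "grad b differentiable (at x)"
    and \<phi>_time: "\<And>j. j \<le> Ns \<Longrightarrow> ((\<lambda>s. \<phi> j x s) has_real_derivative dt (\<phi> j) x t) (at t)"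
    and \<phi>_space: "\<And>j. j \<le> Ns \<Longrightarrow> (\<lambda>y. \<phi> j y t) differentiable (at x)"
    and grad_\<phi>_time: "\<And>j. j \<le> Ns \<Longrightarrow>
      ((\<lambda>s. grad_x (\<phi> j) x s) has_vector_derivative grad_x (dt (\<phi> j)) x t) (at t)"
    and grad_\<phi>_space: "\<And>j. j \<le> Ns \<Longrightarrow> (\<lambda>y. grad_x (\<phi> j) y t) differentiable (at x)"
    and dt_\<phi>_space: "\<And>j. j \<le> Ns \<Longrightarrow> (\<lambda>y. dt (\<phi> j) y t) differentiable (at x)"
begin

text \<open>The field under the divergence in the \<open>i\<close>-th mass equation, restricted to
  the contribution of the \<open>j\<close>-th potential, at the fixed time \<open>t\<close>. The
  energy flux weights it with minus the time derivative of the \<open>i\<close>-th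
  potential.\<close>

definition mass_flux :: "nat \<Rightarrow> nat \<Rightarrow> real^'n \<Rightarrow> real^'n" where
  "mass_flux i j y =
     (1 / (real (p i) + real (p j) + 1) * H y t ^ (p i + p j + 1)) *\<^sub>R grad_x (\<phi> j) y t
     - (real (p j) / (real (p i) + real (p j)) * H y t ^ (p i + p j) * \<phi> j y t) *\<^sub>R grad b y"

lemma mass_flux_differentiable: "j \<le> Ns \<Longrightarrow> mass_flux i j differentiable (at x)"
  unfolding mass_flux_def[abs_def]
  by (intro differentiable_diff differentiable_scaleR differentiable_mult differentiable_power
      differentiable_const H_space \<phi>_space grad_\<phi>_space grad_b_space)

lemma layer_flux_eq:
  "layer_flux Ns p b H \<phi> y t = (\<Sum>i\<le>Ns. \<Sum>j\<le>Ns. (- dt (\<phi> i) y t) *\<^sub>R mass_flux i j y)"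
  unfolding layer_flux_def mass_flux_def
  by (intro sum.cong refl) (simp add: scaleR_diff_right)

lemma layer_flux_term_differentiable:
  "i \<le> Ns \<Longrightarrow> j \<le> Ns \<Longrightarrow> (\<lambda>y. (- dt (\<phi> i) y t) *\<^sub>R mass_flux i j y) differentiable (at x)"
  by (intro differentiable_scaleR differentiable_minus dt_\<phi>_space mass_flux_differentiable)

lemma layer_flux_differentiable: "(\<lambda>y. layer_flux Ns p b H \<phi> y t) differentiable (at x)"
  unfolding layer_flux_eq
  by (intro differentiable_sum finite_atMost) (simp add: layer_flux_term_differentiable del: scaleR_minus_left)

lemma divg_layer_flux:
  "divg (\<lambda>y. layer_flux Ns p b H \<phi> y t) x =
    (\<Sum>i\<le>Ns. \<Sum>j\<le>Ns. - (dt (\<phi> i) x t * divg (mass_flux i j) x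
      + grad_x (dt (\<phi> i)) x t \<bullet> mass_flux i j x))"
proof -
  have "divg (\<lambda>y. layer_flux Ns p b H \<phi> y t) x =
      (\<Sum>i\<le>Ns. \<Sum>j\<le>Ns. divg (\<lambda>y. (- dt (\<phi> i) y t) *\<^sub>R mass_flux i j y) x)"
    unfolding layer_flux_eq
    by (subst divg_sum; (intro differentiable_sum finite_atMost sum.cong refl divg_sum)?)
      (simp_all add: layer_flux_term_differentiable del: scaleR_minus_left)
  also have "\<dots> = (\<Sum>i\<le>Ns. \<Sum>j\<le>Ns. - (dt (\<phi> i) x t * divg (mass_flux i j) x
      + grad_x (dt (\<phi> i)) x t \<bullet> mass_flux i j x))"
  proof (intro sum.cong refl)
    fix i j
    assume ij: "i \<in> {..Ns}" "j \<in> {..Ns}"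
    have "divg (\<lambda>y. (-1) *\<^sub>R (dt (\<phi> i) y t *\<^sub>R mass_flux i j y)) x
        = - 1 * divg (\<lambda>y. dt (\<phi> i) y t *\<^sub>R mass_flux i j y) x"
      using ij by (intro divg_scaleR_const differentiable_scaleR dt_\<phi>_space mass_flux_differentiable) auto
    also have "divg (\<lambda>y. dt (\<phi> i) y t *\<^sub>R mass_flux i j y) x
        = dt (\<phi> i) x t * divg (mass_flux i j) x + grad_x (dt (\<phi> i)) x t \<bullet> mass_flux i j x"
      unfolding grad_x_def using ij by (intro divg_scaleR dt_\<phi>_space mass_flux_differentiable) auto
    finally show "divg (\<lambda>y. (- dt (\<phi> i) y t) *\<^sub>R mass_flux i j y) x =
        - (dt (\<phi> i) x t * divg (mass_flux i j) x + grad_x (dt (\<phi> i)) x t \<bullet> mass_flux i j x)"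
      by simp
  qed
  finally show ?thesis .
qed

text \<open>The depth also takes the place of the elevation in the mass equation, so that
  \<open>dt H\<close> appears there. In this form the balance does not depend on whether the layer
  grows or shrinks when the interface rises.\<close>

lemma layer_energy_balance:
  assumes mass: "\<And>i. i \<le> Ns \<Longrightarrow> lower_mass_eq Ns p b H H \<phi> i x t"
  shows "((\<lambda>s. layer_energy Ns p b H \<phi> x s) has_real_derivative
      dt H x t * ((\<Sum>j\<le>Ns. H x t ^ p j * dt (\<phi> j) x t)
        + 1 / 2 * ((norm (u2 Ns p b H \<phi> x t))\<^sup>2 + (w2 Ns p H \<phi> x t)\<^sup>2))
      - divg (\<lambda>y. layer_flux Ns p b H \<phi> y t) x) (at t)"
proof -
  define h h' \<beta> B where "h = H x t" and "h' = dt H x t" and "\<beta> = grad b x"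
    and "B = 1 + (norm \<beta>)\<^sup>2"
  define f f' G G' where "f i = \<phi> i x t" and "f' i = dt (\<phi> i) x t"
    and "G i = grad_x (\<phi> i) x t" and "G' i = grad_x (dt (\<phi> i)) x t" for i
  define P q where "P i = h ^ p i" and "q i = real (p i) * h powi (int (p i) - 1)" for i
  define a c d where "a i j = 1 / (real (p i) + real (p j) + 1) * h ^ (p i + p j + 1)"
    and "c i j = real (p i) / (real (p i) + real (p j)) * h ^ (p i + p j)"
    and "d i j = real (p i) * real (p j) / (real (p i) + real (p j) - 1)
            * h powi (int (p i) + int (p j) - 1)" for i j
  \<comment> \<open>There is no such rule for \<open>c\<close>, whose numerator contains only
    \<open>p i\<close>.\<close>
  have sym: "a i j = a j i" "d i j = d j i" for i j
    by (simp_all add: a_def d_def add.commute mult.commute)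
  define D where "D i j = a i j * (G' i \<bullet> G j + G i \<bullet> G' j)
        - 2 * c i j * (f' i * (\<beta> \<bullet> G j) + f i * (\<beta> \<bullet> G' j))
        + d i j * B * (f' i * f j + f i * f' j)
        + h' * (P i * P j * (G i \<bullet> G j) - 2 * q i * P j * f i * (\<beta> \<bullet> G j)
            + q i * q j * B * f i * f j)" for i j
  define M where "M i j = divg (mass_flux i j) x" for i j
  \<comment> \<open>\<open>K i j\<close> collects the terms of the \<open>i\<close>-th mass equation
    outside the divergence; \<open>M i j\<close> is the divergence.\<close>
  define K where "K i j = c i j * (\<beta> \<bullet> G j) - d i j * B * f j" for i j
  define U where "U i j = (P i *\<^sub>R G i - (q i * f i) *\<^sub>R \<beta>) \<bullet> (P j *\<^sub>R G j - (q j * f j) *\<^sub>R \<beta>)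
    + (q i * f i) * (q j * f j)" for i j
  have energy: "((\<lambda>s. layer_energy Ns p b H \<phi> x s) has_real_derivative
      1 / 2 * (\<Sum>i\<le>Ns. \<Sum>j\<le>Ns. D i j)) (at t)"
    unfolding layer_energy_def
  proof (intro DERIV_cmult DERIV_sum)
    fix i j
    assume "i \<in> {..Ns}" "j \<in> {..Ns}"
    then have "i \<le> Ns" "j \<le> Ns"
      by auto
    note E = layer_energy_term_derivative[where H = "\<lambda>s. H x s" and q = "p i" and r = "p j"
        and \<beta> = \<beta> and B = B, OF H_nonzero H_time \<phi>_time[OF this(1)] \<phi>_time[OF this(2)]
        grad_\<phi>_time[OF this(1)] grad_\<phi>_time[OF this(2)]]
    show "((\<lambda>s. 1 / (real (p i) + real (p j) + 1) * H x s ^ (p i + p j + 1)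
           * (grad_x (\<phi> i) x s \<bullet> grad_x (\<phi> j) x s)
         - 2 * real (p i) / (real (p i) + real (p j)) * H x s ^ (p i + p j)
           * \<phi> i x s * (grad b x \<bullet> grad_x (\<phi> j) x s)
         + real (p i) * real (p j) / (real (p i) + real (p j) - 1)
           * H x s powi (int (p i) + int (p j) - 1) * (1 + (norm (grad b x))\<^sup>2)
           * \<phi> i x s * \<phi> j x s) has_real_derivative D i j) (at t)"
      by (rule DERIV_cong[OF E[unfolded B_def \<beta>_def]])
        (simp add: D_def a_def c_def d_def P_def q_def B_def f_def f'_def G_def G'_def
          h_def h'_def \<beta>_def)
  qed
  \<comment> \<open>The indices of \<open>c\<close> are exchanged here because the bottom term of
    the flux has \<open>p j\<close> in its numerator, while that of the energy has
    \<open>p i\<close>.\<close>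
  have flux: "divg (\<lambda>y. layer_flux Ns p b H \<phi> y t) x =
      (\<Sum>i\<le>Ns. \<Sum>j\<le>Ns. - (f' i * M i j + G' i \<bullet> (a i j *\<^sub>R G j - (c j i * f j) *\<^sub>R \<beta>)))"
    unfolding divg_layer_flux mass_flux_def M_def f'_def G'_def a_def c_def f_def \<beta>_def h_def G_def
    by (simp only: add.commute)
  have "h' * P i = - (\<Sum>j\<le>Ns. M i j + K i j)" if "i \<le> Ns" for i
  proof -
    have "P i * h' + (\<Sum>j\<le>Ns. M i j + c i j * (\<beta> \<bullet> G j) - d i j * B * f j) = 0"
      using mass[OF that]
      unfolding lower_mass_eq_def M_def mass_flux_def[abs_def] P_def c_def d_def f_def G_def h_def
        h'_def \<beta>_def B_def .
    then show ?thesis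
      by (simp add: K_def add_diff_eq mult.commute)
  qed
  then have "h' * P i * f' i = (\<Sum>j\<le>Ns. - ((M i j + K i j) * f' i))" if "i \<le> Ns" for i
    using that by (simp add: sum_distrib_right sum_negf del: minus_add_distrib)
  then have mass': "h' * (\<Sum>i\<le>Ns. P i * f' i) = (\<Sum>i\<le>Ns. \<Sum>j\<le>Ns. - ((M i j + K i j) * f' i))"
    by (simp add: sum_distrib_left mult.assoc)
  have speed: "(norm (u2 Ns p b H \<phi> x t))\<^sup>2 + (w2 Ns p H \<phi> x t)\<^sup>2 = (\<Sum>i\<le>Ns. \<Sum>j\<le>Ns. U i j)"
  proof -
    have "u2 Ns p b H \<phi> x t = (\<Sum>i\<le>Ns. P i *\<^sub>R G i - (q i * f i) *\<^sub>R \<beta>)"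
      by (simp add: u2_def P_def G_def q_def f_def \<beta>_def h_def)
    moreover have "w2 Ns p H \<phi> x t = (\<Sum>i\<le>Ns. q i * f i)"
      by (simp add: w2_def q_def f_def h_def)
    ultimately show ?thesis
      by (simp only: power2_norm_eq_inner power2_eq_square[of "sum _ _"] inner_sum_left
          inner_sum_right[of "_ - _"] sum_product U_def sum.distrib)
  qed
  \<comment> \<open>The divergences \<open>M i j\<close> cancel within each summand. All other
    contributions only cancel against those of the pair \<open>(j, i)\<close>: the ones with
    \<open>a\<close> and \<open>d\<close> by symmetry, the ones with \<open>c\<close> by
    relabelling, and the ones with \<open>h'\<close> because the cross term of \<open>D\<close> is
    twice one of the two cross terms of \<open>U\<close>.\<close>
  have "(\<Sum>i\<le>Ns. \<Sum>j\<le>Ns. 1 / 2 * D i j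
      - (f' i * M i j + G' i \<bullet> (a i j *\<^sub>R G j - (c j i * f j) *\<^sub>R \<beta>))
      + (M i j + K i j) * f' i - h' / 2 * U i j) = 0"
    by (rule sum_sum_antisymmetric)
      (simp add: D_def K_def U_def B_def power2_norm_eq_inner inner_diff_left inner_diff_right
        sym inner_commute algebra_simps)
  then have total: "1 / 2 * (\<Sum>i\<le>Ns. \<Sum>j\<le>Ns. D i j) =
      h' * ((\<Sum>i\<le>Ns. P i * f' i)
        + 1 / 2 * ((norm (u2 Ns p b H \<phi> x t))\<^sup>2 + (w2 Ns p H \<phi> x t)\<^sup>2))
      - divg (\<lambda>y. layer_flux Ns p b H \<phi> y t) x"
    unfolding flux speed distrib_left mass'
    by (simp add: sum.distrib sum_subtractf sum_negf sum_distrib_left sum_divide_distrib algebra_simps)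
  show ?thesis
    using energy unfolding total unfolding h'_def P_def f'_def h_def .
qed

end

section \<open>The two layers together\<close>

lemma regular_layerI:
  fixes b :: "real^'n::finite \<Rightarrow> real"
  assumes T: "open T" "t \<in> T"
    and b: "C_on 2 UNIV b"
    and \<phi>: "\<And>j. j \<le> Ns \<Longrightarrow> C_on 2 (UNIV \<times> T) (\<lambda>(x, t). \<phi> j x t)"
    and H: "H x t \<noteq> 0" "((\<lambda>s. H x s) has_real_derivative dt H x t) (at t)"
      "(\<lambda>y. H y t) differentiable (at x)"
  shows "regular_layer Ns b H \<phi> x t"
  by unfold_locales
    (use H C2_on_grad_differentiable[OF b] C1_on_spacetime[OF T C2_on_imp_C1_on[OF \<phi>]]
      C2_on_spacetime[OF T \<phi>] in simp_all)

lemma has_real_derivative_imp_dt: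
  assumes "((\<lambda>s. f x s) has_real_derivative D) (at t)"
  shows "((\<lambda>s. f x s) has_real_derivative dt f x t) (at t)" "dt f x t = D"
  using assms DERIV_imp_deriv[OF assms] by (simp_all add: dt_def)

text \<open>The upper layer is a lower layer over a flat bottom, with the exponents \<open>2j\<close> and the
  interface moving in the opposite direction.\<close>

lemma upper_mass_eq_imp_lower_mass_eq:
  assumes "upper_mass_eq N H \<zeta> \<phi> i x t" "dt H x t = - dt \<zeta> x t"
  shows "lower_mass_eq N (\<lambda>j. 2 * j) (\<lambda>_. 0) H H \<phi> i x t"
  using assms
  by (simp add: upper_mass_eq_def lower_mass_eq_def algebra_simps)

lemma u1_eq_u2: "u1 N H \<phi> x t = u2 N (\<lambda>j. 2 * j) (\<lambda>_. 0) H \<phi> x t"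
  by (simp add: u1_def u2_def)

text \<open>The two vertical velocities differ only by a sign, which the square removes.\<close>

lemma w1_sq_eq_w2_sq: "(w1 N H \<phi> x t)\<^sup>2 = (w2 N (\<lambda>j. 2 * j) H \<phi> x t)\<^sup>2"
  by (simp add: w1_def w2_def)

text \<open>The elevation enters the mass equation only through its time derivative. Hence the lower
  depth, which differs from it by a function of position, can replace it.\<close>

lemma lower_mass_eq_cong_dt:
  assumes "dt \<zeta> x t = dt \<eta> x t"
  shows "lower_mass_eq Ns p b H \<zeta> \<phi> i x t = lower_mass_eq Ns p b H \<eta> \<phi> i x t"
  by (simp add: lower_mass_eq_def assms)

text \<open>Over the flat bottom the cross term vanishes and the factor
  \<open>1 + (norm (grad b x))\<^sup>2\<close> becomes 1, which leaves the kinetic energy of the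
  upper layer.\<close>

lemma energy_eq_layers:
  "energy N Ns p g \<rho>1 \<rho>2 b H1 H2 \<zeta> \<phi>1 \<phi>2 x t =
    \<rho>1 * layer_energy N (\<lambda>j. 2 * j) (\<lambda>_. 0) H1 \<phi>1 x t + \<rho>2 * layer_energy Ns p b H2 \<phi>2 x t
    + 1 / 2 * (\<rho>2 - \<rho>1) * g * (\<zeta> x t)\<^sup>2"
  by (simp add: energy_def layer_energy_def distrib_left mult.assoc)

lemma energy_flux_eq_layers:
  "energy_flux N Ns p \<rho>1 \<rho>2 b H1 H2 \<phi>1 \<phi>2 x t =
    \<rho>1 *\<^sub>R layer_flux N (\<lambda>j. 2 * j) (\<lambda>_. 0) H1 \<phi>1 x t + \<rho>2 *\<^sub>R layer_flux Ns p b H2 \<phi>2 x t"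
  by (simp add: energy_flux_def layer_flux_def distrib_left)

theorem proposition9p1:
  fixes N Ns :: nat and p :: "nat \<Rightarrow> nat"
    and g \<rho>1 \<rho>2 h1 h2 :: real
    and T :: "real set"
    and b :: "real^'n::finite \<Rightarrow> real"
    and \<zeta> :: "real^'n \<Rightarrow> real \<Rightarrow> real"
    and \<phi>1 \<phi>2 :: "nat \<Rightarrow> real^'n \<Rightarrow> real \<Rightarrow> real"
  defines "H1 \<equiv> upper_depth h1 \<zeta>"
    and "H2 \<equiv> lower_depth h2 b \<zeta>"
  assumes "p 0 = 0" and "strict_mono_on {..Ns} p"
    and "g > 0" and "\<rho>1 > 0" and "\<rho>2 > 0" and "h1 > 0" and "h2 > 0"
    and "open T" and "is_interval T"
    and "regular_on T N Ns b \<zeta> \<phi>1 \<phi>2"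
    and "\<And>x t. t \<in> T \<Longrightarrow> H1 x t > 0"
    and "\<And>x t. t \<in> T \<Longrightarrow> H2 x t > 0"
    and "\<And>x t. t \<in> T \<Longrightarrow> kakinuma_model N Ns p g \<rho>1 \<rho>2 h1 h2 b \<zeta> \<phi>1 \<phi>2 x t"
  shows "\<forall>x. \<forall>t\<in>T.
    dt (energy N Ns p g \<rho>1 \<rho>2 b H1 H2 \<zeta> \<phi>1 \<phi>2) x t
      + divg (\<lambda>y. energy_flux N Ns p \<rho>1 \<rho>2 b H1 H2 \<phi>1 \<phi>2 y t) x = 0"
proof (intro allI ballI)
  fix x t
  assume t: "t \<in> T"
  note T = \<open>open T\<close> t
  have b: "C_on 2 UNIV b" and \<zeta>: "C_on 1 (UNIV \<times> T) (\<lambda>(x, t). \<zeta> x t)"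
    and \<phi>1: "\<And>j. j \<le> N \<Longrightarrow> C_on 2 (UNIV \<times> T) (\<lambda>(x, t). \<phi>1 j x t)"
    and \<phi>2: "\<And>j. j \<le> Ns \<Longrightarrow> C_on 2 (UNIV \<times> T) (\<lambda>(x, t). \<phi>2 j x t)"
    using \<open>regular_on T N Ns b \<zeta> \<phi>1 \<phi>2\<close> by (simp_all add: regular_on_def)
  note \<zeta>_time = C1_on_spacetime(1)[OF T \<zeta>, of x]
  note \<zeta>_space = C1_on_spacetime(2)[OF T \<zeta>, of x]
  have "((\<lambda>s. H1 x s) has_real_derivative - dt \<zeta> x t) (at t)"
    unfolding H1_def upper_depth_def using \<zeta>_time by (auto intro!: derivative_eq_intros)
  note H1_time = has_real_derivative_imp_dt[of H1, OF this]
  have "((\<lambda>s. H2 x s) has_real_derivative dt \<zeta> x t) (at t)"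
    unfolding H2_def lower_depth_def using \<zeta>_time by (auto intro!: derivative_eq_intros)
  note H2_time = has_real_derivative_imp_dt[of H2, OF this]
  have H1_space: "(\<lambda>y. H1 y t) differentiable (at x)"
    unfolding H1_def upper_depth_def by (intro differentiable_diff differentiable_const \<zeta>_space)
  have "b differentiable (at x)"
    using b by (simp add: numeral_2_eq_2 differentiable_on_eq_differentiable_at)
  then have H2_space: "(\<lambda>y. H2 y t) differentiable (at x)"
    unfolding H2_def lower_depth_def
    by (intro differentiable_diff differentiable_add differentiable_const \<zeta>_space)
  have flat: "C_on 2 UNIV (\<lambda>_ :: real^'n. 0)"
    by (simp add: numeral_2_eq_2)
  have "H1 x t \<noteq> 0" "H2 x t \<noteq> 0"
    using assms(13,14)[OF t, of x] by simp_all
  interpret L1: regular_layer N "\<lambda>j. 2 * j" "\<lambda>_. 0" H1 \<phi>1 x t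
    by (rule regular_layerI[OF T flat \<phi>1 \<open>H1 x t \<noteq> 0\<close> H1_time(1) H1_space])
  interpret L2: regular_layer Ns p b H2 \<phi>2 x t
    by (rule regular_layerI[OF T b \<phi>2 \<open>H2 x t \<noteq> 0\<close> H2_time(1) H2_space])
  have model: "\<And>i. i \<le> N \<Longrightarrow> upper_mass_eq N H1 \<zeta> \<phi>1 i x t"
    "\<And>i. i \<le> Ns \<Longrightarrow> lower_mass_eq Ns p b H2 \<zeta> \<phi>2 i x t"
    "bernoulli_eq N Ns p g \<rho>1 \<rho>2 b H1 H2 \<zeta> \<phi>1 \<phi>2 x t"
    using assms(15)[OF t, of x] by (simp_all add: kakinuma_model_def H1_def H2_def)
  note E1 = L1.layer_energy_balance[OF upper_mass_eq_imp_lower_mass_eq[OF model(1) H1_time(2)]]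
  note E2 = L2.layer_energy_balance[OF model(2)[unfolded lower_mass_eq_cong_dt[of \<zeta> x t H2, OF H2_time(2)[symmetric]]]]
  \<comment> \<open>\<open>?K1\<close> and \<open>?K2\<close> are the brackets of the Bernoulli
    equation without gravity; the missing terms come from the potential energy.\<close>
  let ?K1 = "(\<Sum>j\<le>N. H1 x t ^ (2 * j) * dt (\<phi>1 j) x t)
      + 1 / 2 * ((norm (u1 N H1 \<phi>1 x t))\<^sup>2 + (w1 N H1 \<phi>1 x t)\<^sup>2)"
  let ?K2 = "(\<Sum>j\<le>Ns. H2 x t ^ p j * dt (\<phi>2 j) x t)
      + 1 / 2 * ((norm (u2 Ns p b H2 \<phi>2 x t))\<^sup>2 + (w2 Ns p H2 \<phi>2 x t)\<^sup>2)"
  let ?F1 = "divg (\<lambda>y. layer_flux N (\<lambda>j. 2 * j) (\<lambda>_. 0) H1 \<phi>1 y t) x"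
  let ?F2 = "divg (\<lambda>y. layer_flux Ns p b H2 \<phi>2 y t) x"
  have potential: "((\<lambda>s. 1 / 2 * (\<rho>2 - \<rho>1) * g * (\<zeta> x s)\<^sup>2) has_real_derivative
      (\<rho>2 - \<rho>1) * g * \<zeta> x t * dt \<zeta> x t) (at t)"
    using \<zeta>_time by (auto intro!: derivative_eq_intros)
  have "((\<lambda>s. energy N Ns p g \<rho>1 \<rho>2 b H1 H2 \<zeta> \<phi>1 \<phi>2 x s) has_real_derivative
      \<rho>1 * (- dt \<zeta> x t * ?K1 - ?F1) + \<rho>2 * (dt \<zeta> x t * ?K2 - ?F2)
      + (\<rho>2 - \<rho>1) * g * \<zeta> x t * dt \<zeta> x t) (at t)"
    unfolding energy_eq_layers
    by (intro DERIV_add DERIV_cmult E1[unfolded H1_time(2), folded u1_eq_u2 w1_sq_eq_w2_sq]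
        E2[unfolded H2_time(2)] potential)
  note e = has_real_derivative_imp_dt(2)[of "energy N Ns p g \<rho>1 \<rho>2 b H1 H2 \<zeta> \<phi>1 \<phi>2", OF this]
  have f: "divg (\<lambda>y. energy_flux N Ns p \<rho>1 \<rho>2 b H1 H2 \<phi>1 \<phi>2 y t) x =
      \<rho>1 * divg (\<lambda>y. layer_flux N (\<lambda>j. 2 * j) (\<lambda>_. 0) H1 \<phi>1 y t) x
      + \<rho>2 * divg (\<lambda>y. layer_flux Ns p b H2 \<phi>2 y t) x"
    unfolding energy_flux_eq_layers
    by (simp add: divg_add divg_scaleR_const L1.layer_flux_differentiable L2.layer_flux_differentiable
        differentiable_scaleR)
  \<comment> \<open>The sum of the energy rate and the flux divergence is
    \<open>dt \<zeta> x t\<close> times the right side minus the left side of this equation.\<close>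
  have "\<rho>1 * (?K1 + g * \<zeta> x t) = \<rho>2 * (?K2 + g * \<zeta> x t)"
    using model(3) by (simp add: bernoulli_eq_def algebra_simps)
  then have "dt \<zeta> x t * (\<rho>1 * (?K1 + g * \<zeta> x t)) = dt \<zeta> x t * (\<rho>2 * (?K2 + g * \<zeta> x t))"
    by (rule arg_cong)
  then show "dt (energy N Ns p g \<rho>1 \<rho>2 b H1 H2 \<zeta> \<phi>1 \<phi>2) x t
      + divg (\<lambda>y. energy_flux N Ns p \<rho>1 \<rho>2 b H1 H2 \<phi>1 \<phi>2 y t) x = 0"
    unfolding e f by (simp only: algebra_simps)
qed

end
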